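(* Let $T, C, d \ge 1$ be integers, and let $(\mathbf{x}_{1:T}, \mathbf{y}_{1:T}, \tilde{\mathbf{y}}_{1:T})$ be a random triplet consisting of a feature sequence in $\mathbb{R}^{d\times T}$, a clean label sequence in $\{1,\dots,C\}^T$ and a noisy label sequence in $\{1,\dots,C\}^T$, whose joint distribution satisfies Future Independence and Feature Independence, together with the resulting factorization of the noisy label distribution (all given in the context). Let $\boldsymbol{Q}$ be the true temporal label noise function of this distribution, with $\boldsymbol{Q}_t = \boldsymbol{Q}(t)$. Let $\ell_t$ ($t=1,\dots,T$) be a proper composite loss, and let $\{\boldsymbol{h}_\theta : \theta\in\Theta\}$ be a parametrized family of temporal classification models, where $\boldsymbol{h}_\theta(\mathbf{x}_{1:t})\in\mathbb{R}^C$ is the model's estimate of the vector $\big(p(\mathrm{y}_t = c\mid \mathbf{x}_{1:t})\big)_{c=1}^C$. Define the forward temporal loss by $$\overrightarrow{\ell}_{seq}(\tilde{\boldsymbol{y}}_{1:T}, \boldsymbol{x}_{1:T}, \boldsymbol{h}_\theta) := \sum_{t=1}^T \ell_t\big(\tilde{y}_t, \boldsymbol{Q}_t^\top \boldsymbol{h}_\theta(\boldsymbol{x}_{1:t})\big).$$ Then a classifier that minimizes the empirical forward temporal loss over the noisy labels maximizes the empirical likelihood of the data over the clean labels, in the following sense: $$\operatorname*{argmin}_{\theta\in\Theta}\ \mathbb{E}_{\tilde{\mathbf{y}}_{1:T},\mathbf{x}_{1:T}}\Big[\overrightarrow{\ell}_{seq}(\tilde{\mathbf{y}}_{1:T}, \mathbf{x}_{1:T},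 \boldsymbol{h}_\theta)\Big] \;=\; \operatorname*{argmin}_{\theta\in\Theta}\ \sum_{t=1}^T \mathbb{E}_{\mathbf{y}_{1:t},\mathbf{x}_{1:t}}\Big[\ell_t\big(\mathrm{y}_t, \boldsymbol{h}_\theta(\mathbf{x}_{1:t})\big)\Big].$$
   Context: Setting. A temporal classification task has $C$ classes and $T$ time steps. An instance is a triplet of sequences $(\mathbf{x}_{1:T},\mathbf{y}_{1:T},\tilde{\mathbf{y}}_{1:T})$ drawn from a joint distribution. Here $\mathbf{x}_{1:T}\in\mathcal{X}\subseteq\mathbb{R}^{d\times T}$ is a multivariate time series, $\mathbf{y}_{1:T}\in\{1,\dots,C\}^T$ is the sequence of clean (true) labels, and $\tilde{\mathbf{y}}_{1:T}\in\{1,\dots,C\}^T$ is the sequence of noisy labels. $\mathrm{y}_t$ and $\tilde{\mathrm{y}}_t$ denote the clean and noisy label at time $t$, and $\mathbf{x}_{1:t}$ denotes the first $t$ feature vectors. Standing assumptions. (Future Independence) $p(\mathbf{y}_{1:T}\mid\mathbf{x}_{1:T})=\prod_{t=1}^T p(\mathrm{y}_t\mid\mathbf{x}_{1:t})$. (Feature Independence) $\tilde{\mathbf{y}}_{1:t}$ is conditionally independent of $\mathbf{x}_{1:t}$ given $\mathbf{y}_{1:t}$, for $t=1,\dots,T$. The noisy label distribution is taken to factorize accordingly as $p(\tilde{\mathbf{y}}_{1:T}\mid\mathbf{x}_{1:T})=\prod_{t=1}^T q_t(\tilde{\mathrm{y}}_t\mid\mathbf{x}_{1:t})$, with $$q_t(\tilde{\mathrm{y}}_t\mid\mathbf{x}_{1:t})=\sum_{y=1}^C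 q_t(\tilde{\mathrm{y}}_t\mid\mathrm{y}_t=y)\,p(\mathrm{y}_t=y\mid\mathbf{x}_{1:t}),$$ where $q_t$ denotes a time-dependent probability. Temporal label noise function. This is the matrix-valued function $\boldsymbol{Q}:\mathbb{R}_+\to[0,1]^{C\times C}$ specifying the label noise distribution at any time $t>0$. The $(i,j)$ entry of $\boldsymbol{Q}_t:=\boldsymbol{Q}(t)$ is $q_t(\tilde{\mathrm{y}}_t=j\mid\mathrm{y}_t=i)$. Each $\boldsymbol{Q}_t$ is positive, row-stochastic and diagonally dominant. Models and losses. A model $\boldsymbol{h}_\theta$, $\theta\in\Theta$, takes a sequence $\mathbf{x}_{1:t}\in\mathbb{R}^{d\times t}$ for any $t\le T$ and returns a probability vector in $\mathbb{R}^C$. It is written $\boldsymbol{h}_\theta=\boldsymbol{\psi}^{-1}\circ\boldsymbol{g}_\theta$, where $\boldsymbol{g}_\theta$ is the vector of final logits and $\boldsymbol{\psi}:\Delta^{C-1}\to\mathbb{R}^C$ is an invertible link function on the probability simplex $\Delta^{C-1}$ (e.g. $\boldsymbol{\psi}^{-1}$ is the softmax). The function $\ell_t(y,\boldsymbol{p})$ is a loss of a label $y\in\{1,\dots,C\}$ and a probability vector $\boldsymbol{p}\in\Delta^{C-1}$. "Proper composite" means that the loss on logits has the form $(y,\boldsymbol{v})\mapsto\ell_t(y,\boldsymbol{\psi}^{-1}(\boldsymbol{v}))$ with $\ell_t$ proper: for every $\boldsymbol{\pi}\in\Delta^{C-1}$, the expected loss $\sum_{c}\pi_c\,\ell_t(c,\boldsymbol{p})$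 is minimized over $\boldsymbol{p}\in\Delta^{C-1}$ at $\boldsymbol{p}=\boldsymbol{\pi}$. The reference to likelihood corresponds to the negative log-likelihood loss $\ell_t(y,\boldsymbol{h}_\theta(\boldsymbol{x}_{1:t}))=-\log p_\theta(\mathrm{y}_t=y\mid\mathbf{x}_{1:t}=\boldsymbol{x}_{1:t})$, where $p_\theta(\mathrm{y}_t=\cdot\mid\mathbf{x}_{1:t}=\boldsymbol{x}_{1:t})$ is the distribution given by $\boldsymbol{h}_\theta(\boldsymbol{x}_{1:t})$.
   Formalization: The claim fails for arbitrary families and merely proper losses; the formal version adds that some model in the family equals the true clean class posterior almost surely, that each loss is strictly proper, and reads "diagonally dominant" as strictly dominant. *)

theory Defs
  imports "HOL-Probability.Probability"
begin

text \<open>Sequences indexed by time are functions on \<^typ>\<open>nat\<close>; only the times \<open>1, \<dots>, T\<close> matter.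
  Features live in \<open>real ^ 'd\<close>, class labels in a finite type \<open>'c\<close>.\<close>

definition upto_time :: "nat \<Rightarrow> (nat \<Rightarrow> 'a) \<Rightarrow> nat \<Rightarrow> 'a" where
  "upto_time t s = restrict s {1..t}"

definition history :: "(nat \<Rightarrow> 'w \<Rightarrow> 'a) \<Rightarrow> nat \<Rightarrow> 'w \<Rightarrow> nat \<Rightarrow> 'a" where
  "history X t \<omega> = upto_time t (\<lambda>i. X i \<omega>)"

abbreviation feature_space :: "nat \<Rightarrow> (nat \<Rightarrow> real ^ 'd) measure" where
  "feature_space t \<equiv> PiM {1..t} (\<lambda>_. borel)"

abbreviation label_space :: "nat \<Rightarrow> (nat \<Rightarrow> 'c) measure" where
  "label_space t \<equiv> PiM {1..t} (\<lambda>_. count_space UNIV)"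

text \<open>\<open>cond_pr M X N P\<close> is (a version of) the random variable \<open>\<omega> \<mapsto> p(P | X)\<close>, the conditional
  probability of the event \<open>P\<close> given the sigma-algebra generated by \<open>X : M \<rightarrow> N\<close>. Being determined
  only almost surely, it occurs below only under \<open>AE\<close>.\<close>

definition cond_pr :: "'w measure \<Rightarrow> ('w \<Rightarrow> 'a) \<Rightarrow> 'a measure \<Rightarrow> ('w \<Rightarrow> bool) \<Rightarrow> 'w \<Rightarrow> real" where
  "cond_pr M X N P =
     real_cond_exp M (vimage_algebra (space M) X N) (indicator {\<omega> \<in> space M. P \<omega>})"

definition cond_indep_vars ::
  "'w measure \<Rightarrow> ('w \<Rightarrow> 'a) \<Rightarrow> 'a measure \<Rightarrow> ('w \<Rightarrow> 'b) \<Rightarrow> 'b measure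
     \<Rightarrow> ('w \<Rightarrow> 'e) \<Rightarrow> 'e measure \<Rightarrow> bool" where
  "cond_indep_vars M U NU V NV Z NZ \<longleftrightarrow>
     (\<forall>A \<in> sets NU. \<forall>B \<in> sets NV. AE \<omega> in M.
        cond_pr M Z NZ (\<lambda>w. U w \<in> A \<and> V w \<in> B) \<omega>
          = cond_pr M Z NZ (\<lambda>w. U w \<in> A) \<omega> * cond_pr M Z NZ (\<lambda>w. V w \<in> B) \<omega>)"

definition future_independence ::
  "'w measure \<Rightarrow> nat \<Rightarrow> (nat \<Rightarrow> 'w \<Rightarrow> real ^ 'd) \<Rightarrow> (nat \<Rightarrow> 'w \<Rightarrow> 'c) \<Rightarrow> bool" where
  "future_independence M T x y \<longleftrightarrow>
     (\<forall>s. AE \<omega> in M.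
        cond_pr M (history x T) (feature_space T) (\<lambda>w. \<forall>t\<in>{1..T}. y t w = s t) \<omega>
          = (\<Prod>t = 1..T. cond_pr M (history x t) (feature_space t) (\<lambda>w. y t w = s t) \<omega>))"

definition feature_independence ::
  "'w measure \<Rightarrow> nat \<Rightarrow> (nat \<Rightarrow> 'w \<Rightarrow> real ^ 'd) \<Rightarrow> (nat \<Rightarrow> 'w \<Rightarrow> 'c) \<Rightarrow> (nat \<Rightarrow> 'w \<Rightarrow> 'c) \<Rightarrow> bool" where
  "feature_independence M T x y yn \<longleftrightarrow>
     (\<forall>t \<in> {1..T}. cond_indep_vars M (history yn t) (label_space t)
        (history x t) (feature_space t) (history y t) (label_space t))"

text \<open>The noisy label distribution factorizes over time, and its factors are mixtures of the rows of
  \<open>Q\<close> weighted by the clean class probabilities.\<close>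

definition noisy_factorization ::
  "'w measure \<Rightarrow> nat \<Rightarrow> (nat \<Rightarrow> 'w \<Rightarrow> real ^ 'd) \<Rightarrow> (nat \<Rightarrow> 'w \<Rightarrow> 'c::finite) \<Rightarrow> (nat \<Rightarrow> 'w \<Rightarrow> 'c)
     \<Rightarrow> (real \<Rightarrow> real ^ 'c ^ 'c) \<Rightarrow> bool" where
  "noisy_factorization M T x y yn Q \<longleftrightarrow>
     (\<forall>s. AE \<omega> in M.
        cond_pr M (history x T) (feature_space T) (\<lambda>w. \<forall>t\<in>{1..T}. yn t w = s t) \<omega>
          = (\<Prod>t = 1..T. cond_pr M (history x t) (feature_space t) (\<lambda>w. yn t w = s t) \<omega>)) \<and>
     (\<forall>t \<in> {1..T}. \<forall>j. AE \<omega> in M.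
        cond_pr M (history x t) (feature_space t) (\<lambda>w. yn t w = j) \<omega>
          = (\<Sum>i\<in>UNIV. Q (real t) $ i $ j
                * cond_pr M (history x t) (feature_space t) (\<lambda>w. y t w = i) \<omega>))"

text \<open>Entry \<open>(i, j)\<close> of \<open>Q t\<close> is the probability of the noisy label \<open>j\<close> given the clean label \<open>i\<close>.
  The product form leaves row \<open>i\<close> unconstrained when the clean label \<open>i\<close> has probability zero.
  Dominance of the diagonal is strict: the \<open>2 \<times> 2\<close> matrix with all entries \<open>1/2\<close>, which erases
  the clean label, is excluded.\<close>

definition noise_matrix :: "real ^ 'c ^ 'c \<Rightarrow> bool" where
  "noise_matrix A \<longleftrightarrow>
     (\<forall>i j. 0 < A $ i $ j) \<and>
     (\<forall>i. (\<Sum>j\<in>UNIV. A $ i $ j) = 1) \<and>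
     (\<forall>i. (\<Sum>j\<in>UNIV - {i}. \<bar>A $ i $ j\<bar>) < \<bar>A $ i $ i\<bar>)"

definition label_noise_function ::
  "'w measure \<Rightarrow> nat \<Rightarrow> (nat \<Rightarrow> 'w \<Rightarrow> 'c::finite) \<Rightarrow> (nat \<Rightarrow> 'w \<Rightarrow> 'c) \<Rightarrow> (real \<Rightarrow> real ^ 'c ^ 'c) \<Rightarrow> bool" where
  "label_noise_function M T y yn Q \<longleftrightarrow>
     (\<forall>t > 0. noise_matrix (Q t)) \<and>
     (\<forall>t \<in> {1..T}. \<forall>i j.
        measure M {\<omega> \<in> space M. yn t \<omega> = j \<and> y t \<omega> = i}
          = Q (real t) $ i $ j * measure M {\<omega> \<in> space M. y t \<omega> = i})"

definition prob_simplex :: "(real ^ 'c) set" where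
  "prob_simplex = {p. (\<forall>c. 0 \<le> p $ c) \<and> (\<Sum>c\<in>UNIV. p $ c) = 1}"

text \<open>\<open>\<phi>\<close> is the inverse of the link \<open>\<psi>\<close>. Invertibility is required only on the interior of the simplex,
  so that the softmax (whose values are never on the boundary) is an instance of \<open>\<phi>\<close>.\<close>

definition link_with_inverse :: "(real ^ 'c \<Rightarrow> real ^ 'c) \<Rightarrow> (real ^ 'c \<Rightarrow> real ^ 'c) \<Rightarrow> bool" where
  "link_with_inverse \<psi> \<phi> \<longleftrightarrow>
     (\<forall>v. \<phi> v \<in> prob_simplex) \<and> (\<forall>p \<in> prob_simplex. (\<forall>c. 0 < p $ c) \<longrightarrow> \<phi> (\<psi> p) = p)"

text \<open>Losses take values in \<open>(-\<infinity>, \<infinity>]\<close>, so that the negative log-likelihood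
  \<open>(c, p) \<mapsto> - log (p $ c)\<close>, infinite where \<open>p $ c = 0\<close>, is included. In \<^typ>\<open>ereal\<close>, \<open>0 * \<infinity> = 0\<close>.\<close>

definition loss_function :: "('c \<Rightarrow> real ^ 'c \<Rightarrow> ereal) \<Rightarrow> bool" where
  "loss_function l \<longleftrightarrow>
     (\<forall>c. \<forall>p \<in> prob_simplex. l c p \<noteq> -\<infinity>) \<and>
     (\<forall>c. l c \<in> borel_measurable (restrict_space borel prob_simplex))"

definition expected_loss :: "('c \<Rightarrow> real ^ 'c \<Rightarrow> ereal) \<Rightarrow> real ^ 'c \<Rightarrow> real ^ 'c \<Rightarrow> ereal" where
  "expected_loss l \<pi> p = (\<Sum>c\<in>UNIV. ereal (\<pi> $ c) * l c p)"

definition proper_loss :: "('c \<Rightarrow> real ^ 'c \<Rightarrow> ereal) \<Rightarrow> bool" where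
  "proper_loss l \<longleftrightarrow>
     (\<forall>\<pi> \<in> prob_simplex. \<forall>p \<in> prob_simplex. expected_loss l \<pi> \<pi> \<le> expected_loss l \<pi> p)"

definition strictly_proper_loss :: "('c \<Rightarrow> real ^ 'c \<Rightarrow> ereal) \<Rightarrow> bool" where
  "strictly_proper_loss l \<longleftrightarrow> proper_loss l \<and>
     (\<forall>\<pi> \<in> prob_simplex. \<forall>p \<in> prob_simplex.
        expected_loss l \<pi> p = expected_loss l \<pi> \<pi> \<longrightarrow> p = \<pi>)"

text \<open>The loss on logits is the composite \<open>(c, v) \<mapsto> l c (\<phi> v)\<close>.\<close>

definition proper_composite_loss ::
  "(real ^ 'c \<Rightarrow> real ^ 'c) \<Rightarrow> (real ^ 'c \<Rightarrow> real ^ 'c) \<Rightarrow> ('c \<Rightarrow> real ^ 'c \<Rightarrow> ereal) \<Rightarrow> bool" where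
  "proper_composite_loss \<psi> \<phi> l \<longleftrightarrow>
     link_with_inverse \<psi> \<phi> \<and> loss_function l \<and> proper_loss l"

text \<open>A model \<open>h\<close> maps a length \<open>t\<close> and a feature sequence \<open>x\<^sub>1, \<dots>, x\<^sub>t\<close> to a vector of class
  probabilities, obtained from the logits \<open>g\<close>.\<close>

definition temporal_model ::
  "nat \<Rightarrow> (real ^ 'c \<Rightarrow> real ^ 'c) \<Rightarrow> (nat \<Rightarrow> (nat \<Rightarrow> real ^ 'd) \<Rightarrow> real ^ 'c)
     \<Rightarrow> (nat \<Rightarrow> (nat \<Rightarrow> real ^ 'd) \<Rightarrow> real ^ 'c) \<Rightarrow> bool" where
  "temporal_model T \<phi> g h \<longleftrightarrow>
     (\<forall>t \<in> {1..T}. h t \<in> borel_measurable (feature_space t) \<and>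
        (\<forall>s \<in> space (feature_space t). h t s = \<phi> (g t s)))"

definition estimates_posterior_exactly ::
  "'w measure \<Rightarrow> nat \<Rightarrow> (nat \<Rightarrow> 'w \<Rightarrow> real ^ 'd) \<Rightarrow> (nat \<Rightarrow> 'w \<Rightarrow> 'c)
     \<Rightarrow> (nat \<Rightarrow> (nat \<Rightarrow> real ^ 'd) \<Rightarrow> real ^ 'c) \<Rightarrow> bool" where
  "estimates_posterior_exactly M T x y h \<longleftrightarrow>
     (\<forall>t \<in> {1..T}. \<forall>c. AE \<omega> in M.
        h t (history x t \<omega>) $ c
          = cond_pr M (history x t) (feature_space t) (\<lambda>w. y t w = c) \<omega>)"

definition forward_temporal_loss ::
  "nat \<Rightarrow> (nat \<Rightarrow> 'c \<Rightarrow> real ^ 'c \<Rightarrow> ereal) \<Rightarrow> (real \<Rightarrow> real ^ 'c ^ 'c)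
     \<Rightarrow> (nat \<Rightarrow> 'c) \<Rightarrow> (nat \<Rightarrow> real ^ 'd) \<Rightarrow> (nat \<Rightarrow> (nat \<Rightarrow> real ^ 'd) \<Rightarrow> real ^ 'c) \<Rightarrow> ereal" where
  "forward_temporal_loss T l Q ys xs h =
     (\<Sum>t = 1..T. l t (ys t) (transpose (Q (real t)) *v h t (upto_time t xs)))"

text \<open>Expectation of an extended real random variable as the difference of the integrals of its positive
  and negative parts (\<^const>\<open>e2ennreal\<close> sends negative numbers to \<open>0\<close>). The case \<open>\<infinity> - \<infinity>\<close> does not arise
  for the losses above: properness bounds \<open>l c\<close> below by its value at the vertex \<open>c\<close> of the simplex.\<close>

definition ereal_expectation :: "'w measure \<Rightarrow> ('w \<Rightarrow> ereal) \<Rightarrow> ereal" where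
  "ereal_expectation M f =
     enn2ereal (\<integral>\<^sup>+ \<omega>. e2ennreal (f \<omega>) \<partial>M) - enn2ereal (\<integral>\<^sup>+ \<omega>. e2ennreal (- f \<omega>) \<partial>M)"

definition argmin_set :: "('p \<Rightarrow> ereal) \<Rightarrow> 'p set \<Rightarrow> 'p set" where
  "argmin_set f S = {\<theta>. is_arg_min f (\<lambda>\<theta>. \<theta> \<in> S) \<theta>}"

end

theory Submission
  imports Defs
begin

text \<open>Conditioning on the features turns both objectives into sums over \<open>t\<close> of integrals of expected
  losses: of the model \<open>p\<close> under the posterior \<open>\<pi>\<close> for the clean labels, and of \<open>Q\<^sup>T p\<close> under \<open>Q\<^sup>T \<pi>\<close>
  for the noisy ones. By strict properness each integrand is pointwise minimal exactly at \<open>p = \<pi>\<close>,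
  respectively \<open>Q\<^sup>T p = Q\<^sup>T \<pi>\<close>, and these agree because strict diagonal dominance makes \<open>Q\<^sup>T\<close>
  injective. As some model attains \<open>\<pi>\<close>, both argmin sets consist of the models almost surely equal
  to \<open>\<pi>\<close>, provided the minimum is finite: strict properness makes the uniform distribution
  have finite loss on every label, which bounds the minimal expected loss. Only over a single class
  can this fail, and then all models coincide.\<close>

section \<open>Extended-real arithmetic and expectations of functions bounded below\<close>

lemma e2ennreal_add:
  assumes "0 \<le> a" "0 \<le> b"
  shows "e2ennreal (a + b) = e2ennreal a + e2ennreal b"
  by (metis assms e2ennreal_enn2ereal enn2ereal_e2ennreal plus_ennreal.rep_eq)

lemma e2ennreal_sum:
  assumes "\<And>i. i \<in> I \<Longrightarrow> 0 \<le> f i"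
  shows "e2ennreal (\<Sum>i\<in>I. f i) = (\<Sum>i\<in>I. e2ennreal (f i))"
  using assms by (induction I rule: infinite_finite_induct) (auto simp: e2ennreal_add sum_nonneg e2ennreal_neg)

lemma enn2ereal_sum: "enn2ereal (\<Sum>i\<in>I. f i) = (\<Sum>i\<in>I. enn2ereal (f i))"
  by (induction I rule: infinite_finite_induct) (auto simp: plus_ennreal.rep_eq zero_ennreal.rep_eq)

lemma ereal_shift_nonneg:
  assumes "- ereal b \<le> a"
  shows "0 \<le> a + ereal b"
  using assms by (cases a) auto

lemma ereal_sum_add_const:
  fixes f :: "'i \<Rightarrow> ereal"
  shows "(\<Sum>i\<in>I. f i + ereal (b i)) = (\<Sum>i\<in>I. f i) + ereal (\<Sum>i\<in>I. b i)"
  by (simp add: sum.distrib)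

lemma ereal_sum_minus_const:
  fixes f :: "'i \<Rightarrow> ereal"
  shows "(\<Sum>i\<in>I. f i - ereal (b i)) = (\<Sum>i\<in>I. f i) - ereal (\<Sum>i\<in>I. b i)"
  using ereal_sum_add_const[of f "\<lambda>i. - b i" I] by (simp add: minus_ereal_def sum_negf)

text \<open>A function bounded below by \<open>- b\<close> has a negative part of integral at most
  \<open>b\<close>, so the difference defining its expectation is never \<infinity> - \<infinity>.
  One nonnegative integral then carries all the information, up to a real constant.\<close>

lemma ereal_expectation_shift:
  assumes "prob_space M" and [measurable]: "f \<in> borel_measurable M"
    and b: "0 \<le> b" "\<And>\<omega>. \<omega> \<in> space M \<Longrightarrow> - ereal b \<le> f \<omega>"
  shows "ereal_expectation M f = enn2ereal (\<integral>\<^sup>+ \<omega>. e2ennreal (f \<omega> + ereal b) \<partial>M) - ereal b"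
proof -
  interpret prob_space M by fact
  define A P N where "A = (\<integral>\<^sup>+ \<omega>. e2ennreal (f \<omega> + ereal b) \<partial>M)"
    and "P = (\<integral>\<^sup>+ \<omega>. e2ennreal (f \<omega>) \<partial>M)" and "N = (\<integral>\<^sup>+ \<omega>. e2ennreal (- f \<omega>) \<partial>M)"
  \<comment> \<open>The identity f + b = f^+ - f^- + b, arranged without subtraction so that it
    holds in \<open>ennreal\<close> even where \<open>f\<close> is infinite.\<close>
  have split: "e2ennreal (f \<omega> + ereal b) + e2ennreal (- f \<omega>) = e2ennreal (f \<omega>) + ennreal b"
    if "\<omega> \<in> space M" for \<omega>
  proof (cases "f \<omega>")
    case (real r)
    then show ?thesis
      using b(1) b(2)[OF that]
      by (cases "0 \<le> r") (auto simp: ennreal_plus[symmetric] ennreal_neg simp del: ennreal_plus)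
  qed (use b(2)[OF that] in \<open>auto simp: e2ennreal_neg\<close>)
  have "A + N = P + ennreal b"
    unfolding A_def N_def P_def
    by (subst nn_integral_add[symmetric], measurable, subst nn_integral_cong[OF split])
       (auto simp: nn_integral_add emeasure_space_1)
  \<comment> \<open>Finiteness of \<open>N\<close> is what allows it to be cancelled when
    \<open>A\<close> and \<open>P\<close> are infinite.\<close>
  moreover have "e2ennreal (- f \<omega>) \<le> ennreal b" if "\<omega> \<in> space M" for \<omega>
    using e2ennreal_mono[of "- f \<omega>" "ereal b"] b(2)[OF that] by (simp add: ereal_uminus_le_reorder)
  then have "N \<le> ennreal b"
    unfolding N_def using nn_integral_mono[of M "\<lambda>\<omega>. e2ennreal (- f \<omega>)" "\<lambda>_. ennreal b"]
    by (simp add: emeasure_space_1)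
  then obtain n where n: "N = ennreal n" "0 \<le> n" "n \<le> b"
    using b(1) by (cases N) (auto simp: top_unique)
  ultimately have "enn2ereal P - enn2ereal N = enn2ereal A - ereal b"
    using b(1) by (cases A; cases P) 
      (auto simp: ennreal_plus[symmetric] enn2ereal_ennreal top_ereal_def simp del: ennreal_plus)
  then show ?thesis
    by (simp add: ereal_expectation_def A_def P_def N_def)
qed

section \<open>Conditioning, and minimizers of integrals\<close>

text \<open>The defining property of conditional expectation, tested against the weight
  \<open>k (X \<omega>)\<close>, which is measurable for the sigma-algebra generated by
  \<open>X\<close>. Weights in \<open>ennreal\<close> accommodate infinite losses.\<close>

lemma nn_integral_cond_pr:
  assumes "prob_space M" and [measurable]: "X \<in> measurable M N" "z \<in> measurable M (count_space UNIV)"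
    and [measurable]: "k \<in> borel_measurable N"
    and \<pi>: "AE \<omega> in M. \<pi> \<omega> = cond_pr M X N (\<lambda>w. z w = c) \<omega>"
  shows "(\<integral>\<^sup>+ \<omega>. k (X \<omega>) * indicator {\<omega> \<in> space M. z \<omega> = c} \<omega> \<partial>M)
       = (\<integral>\<^sup>+ \<omega>. ennreal (\<pi> \<omega>) * k (X \<omega>) \<partial>M)"
proof -
  interpret prob_space M by fact
  define F where "F = vimage_algebra (space M) X N"
  define S where "S = {\<omega> \<in> space M. z \<omega> = c}"
  have [measurable]: "S \<in> sets M"
    unfolding S_def by measurable
  have X_space: "X \<in> space M \<rightarrow> space N"
    using assms(2) by (auto simp: measurable_def)
  have "subalgebra M F"
    unfolding subalgebra_def F_def
    using assms(2) by (auto simp: sets_vimage_algebra2[OF X_space] intro: measurable_sets)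
  then interpret finite_measure_subalgebra M F
    by unfold_locales
  have [measurable]: "(\<lambda>\<omega>. k (X \<omega>)) \<in> borel_measurable F"
    unfolding F_def using X_space
    by (intro measurable_compose[OF measurable_vimage_algebra1]) auto
  \<comment> \<open>\<open>cond_pr\<close> is real-valued, built with \<open>enn2real\<close> from
    \<open>nn_cond_exp\<close> of the positive and negative parts. The bound
    \<open>e \<le> 1\<close> makes \<open>enn2real\<close> invertible here, and the negative part
    contributes 0.\<close>
  define e where "e = nn_cond_exp M F (indicator S)"
  have "AE \<omega> in M. e \<omega> \<le> nn_cond_exp M F (\<lambda>_. 1) \<omega>"
    unfolding e_def by (rule nn_cond_exp_mono) (auto simp: indicator_def)
  moreover have "AE \<omega> in M. 1 = nn_cond_exp M F (\<lambda>_. 1) \<omega>"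
    by (rule nn_cond_exp_F_meas) auto
  moreover have "AE \<omega> in M. 0 = nn_cond_exp M F (\<lambda>_. 0) \<omega>"
    by (rule nn_cond_exp_F_meas) auto
  ultimately have "AE \<omega> in M. ennreal (\<pi> \<omega>) = e \<omega>"
    using \<pi>
  proof eventually_elim
    case (elim \<omega>)
    moreover have "(\<lambda>\<omega>. ennreal (- indicator S \<omega>)) = (\<lambda>_. 0)" "(\<lambda>\<omega>. ennreal (indicator S \<omega>)) = indicator S"
      by (auto simp: indicator_def ennreal_neg)
    ultimately have "\<pi> \<omega> = enn2real (e \<omega>)" and "e \<omega> \<le> 1"
      by (simp_all add: cond_pr_def real_cond_exp_def F_def[symmetric] S_def[symmetric] e_def)
    then show ?case
      by (simp add: top_unique less_top[symmetric] ennreal_enn2real_if) (auto simp: top_unique)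
  qed
  then have "(\<integral>\<^sup>+ \<omega>. ennreal (\<pi> \<omega>) * k (X \<omega>) \<partial>M) = (\<integral>\<^sup>+ \<omega>. k (X \<omega>) * e \<omega> \<partial>M)"
    by (intro nn_integral_cong_AE) (auto simp: mult.commute)
  also have "\<dots> = (\<integral>\<^sup>+ \<omega>. k (X \<omega>) * indicator S \<omega> \<partial>M)"
    unfolding e_def by (rule nn_cond_exp_intg) auto
  finally show ?thesis
    by (simp add: S_def)
qed

text \<open>If one integrand lies below all others, attaining the minimal integral means equality of
  integrals, and a nonnegative difference with integral zero vanishes almost everywhere. This needs
  a finite minimum; the other alternative in \<open>fin\<close> covers an infinite one by letting
  all integrands agree.\<close>

lemma argmin_set_integral:
  fixes F :: "'p \<Rightarrow> 'w \<Rightarrow> ennreal" and b :: real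
  assumes "\<theta>\<^sub>0 \<in> \<Theta>"
    and [measurable]: "\<And>\<theta>. \<theta> \<in> \<Theta> \<Longrightarrow> F \<theta> \<in> borel_measurable M"
    and min: "\<And>\<theta> \<omega>. \<theta> \<in> \<Theta> \<Longrightarrow> \<omega> \<in> space M \<Longrightarrow> F \<theta>\<^sub>0 \<omega> \<le> F \<theta> \<omega>"
    and fin: "integral\<^sup>N M (F \<theta>\<^sub>0) < \<infinity> \<or> (\<forall>\<theta>\<in>\<Theta>. \<forall>\<omega>\<in>space M. F \<theta> \<omega> = F \<theta>\<^sub>0 \<omega>)"
    and obj: "\<And>\<theta>. \<theta> \<in> \<Theta> \<Longrightarrow> r \<theta> = enn2ereal (integral\<^sup>N M (F \<theta>)) - ereal b"
  shows "argmin_set r \<Theta> = {\<theta> \<in> \<Theta>. AE \<omega> in M. F \<theta> \<omega> = F \<theta>\<^sub>0 \<omega>}"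
proof -
  have less: "r \<theta> < r \<theta>' \<longleftrightarrow> integral\<^sup>N M (F \<theta>) < integral\<^sup>N M (F \<theta>')" if "\<theta> \<in> \<Theta>" "\<theta>' \<in> \<Theta>" for \<theta> \<theta>'
    unfolding obj[OF that(1)] obj[OF that(2)] less_ennreal.rep_eq
    by (cases "enn2ereal (integral\<^sup>N M (F \<theta>))"; cases "enn2ereal (integral\<^sup>N M (F \<theta>'))") auto
  have le: "integral\<^sup>N M (F \<theta>\<^sub>0) \<le> integral\<^sup>N M (F \<theta>)" if "\<theta> \<in> \<Theta>" for \<theta>
    using min[OF that] by (rule nn_integral_mono)
  have eq: "(AE \<omega> in M. F \<theta> \<omega> = F \<theta>\<^sub>0 \<omega>) \<longleftrightarrow> integral\<^sup>N M (F \<theta>) = integral\<^sup>N M (F \<theta>\<^sub>0)" if "\<theta> \<in> \<Theta>" for \<theta>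
  proof
    assume *: "integral\<^sup>N M (F \<theta>) = integral\<^sup>N M (F \<theta>\<^sub>0)"
    from fin show "AE \<omega> in M. F \<theta> \<omega> = F \<theta>\<^sub>0 \<omega>"
    proof
      assume f: "integral\<^sup>N M (F \<theta>\<^sub>0) < \<infinity>"
      have "(\<integral>\<^sup>+ \<omega>. F \<theta> \<omega> - F \<theta>\<^sub>0 \<omega> \<partial>M) = 0"
        using f that assms(1) min * by (subst nn_integral_diff) auto
      then have "AE \<omega> in M. F \<theta> \<omega> - F \<theta>\<^sub>0 \<omega> = 0"
        using that assms(1) by (subst (asm) nn_integral_0_iff_AE) auto
      moreover have "AE \<omega> in M. F \<theta>\<^sub>0 \<omega> \<noteq> \<infinity>"
        using f assms(1) by (intro nn_integral_noteq_infinite) auto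
      ultimately show ?thesis
        using AE_space
      proof eventually_elim
        case (elim \<omega>)
        then show ?case
          using min[OF that elim(3)] by (metis diff_eq_0_iff_ennreal infinity_ennreal_def order_antisym order_less_imp_le)
      qed
    qed (use that in auto)
  qed (rule nn_integral_cong_AE)
  \<comment> \<open>Since \<open>\<theta>\<^sub>0\<close> is itself a competitor with least
    integral, an unbeaten \<theta> must have the same integral.\<close>
  have "(\<forall>\<theta>'\<in>\<Theta>. \<not> r \<theta>' < r \<theta>) \<longleftrightarrow> (AE \<omega> in M. F \<theta> \<omega> = F \<theta>\<^sub>0 \<omega>)" if "\<theta> \<in> \<Theta>" for \<theta>
    unfolding eq[OF that] using less[OF _ that] le assms(1) that
    by (metis not_less order_antisym)
  then show ?thesis
    unfolding argmin_set_def is_arg_min_def by auto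
qed

section \<open>Noise matrices acting on the simplex\<close>

text \<open>Dominance is by rows but the equations run over columns, so the estimate is made in the
  l1 norm instead of at a largest coordinate. With row sums 1 every diagonal entry exceeds 1/2, and
  summing over all coordinates leaves nonnegative terms
  \<open>(2 * A $ j $ j - 1) * \<bar>d $ j\<bar>\<close> with total at most 0.\<close>

lemma transpose_noise_matrix_inj:
  fixes A :: "real ^ 'c::finite ^ 'c"
  assumes A: "noise_matrix A" and eq: "transpose A *v u = transpose A *v v"
  shows "u = v"
proof -
  define d where "d = u - v"
  have pos: "0 < A $ i $ j" and row: "(\<Sum>j\<in>UNIV. A $ i $ j) = 1"
    and dom: "(\<Sum>j\<in>UNIV - {i}. \<bar>A $ i $ j\<bar>) < \<bar>A $ i $ i\<bar>" for i j
    using A by (auto simp: noise_matrix_def)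
  have half: "1 < 2 * A $ i $ i" for i
    using dom[of i] row[of i] pos less_imp_le[OF pos]
    by (simp add: sum.remove[of UNIV i "\<lambda>j. A $ i $ j"])
  have zero: "(\<Sum>i\<in>UNIV. A $ i $ j * d $ i) = 0" for j
  proof -
    have "transpose A *v d = 0"
      using eq by (simp add: d_def matrix_vector_mult_diff_distrib)
    then have "(transpose A *v d) $ j = 0"
      by simp
    then show ?thesis
      by (simp add: matrix_vector_mult_def transpose_def)
  qed
  \<comment> \<open>The diagonal term is added on both sides: the right side becomes a full column
    sum, and after interchanging the sums over \<open>i\<close> and \<open>j\<close> the row sums
    can be used.\<close>
  have "2 * A $ j $ j * \<bar>d $ j\<bar> \<le> (\<Sum>i\<in>UNIV. A $ i $ j * \<bar>d $ i\<bar>)" for j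
  proof -
    have "A $ j $ j * d $ j = - (\<Sum>i\<in>UNIV - {j}. A $ i $ j * d $ i)"
      using zero[of j] by (simp add: sum.remove[of UNIV j])
    then have "A $ j $ j * \<bar>d $ j\<bar> = \<bar>\<Sum>i\<in>UNIV - {j}. A $ i $ j * d $ i\<bar>"
      using pos[of j j] by (metis abs_minus_cancel abs_mult abs_of_pos)
    also have "\<dots> \<le> (\<Sum>i\<in>UNIV - {j}. A $ i $ j * \<bar>d $ i\<bar>)"
      using pos by (intro order_trans[OF sum_abs] sum_mono) (simp add: abs_mult abs_of_pos)
    finally show ?thesis
      by (simp add: sum.remove[of UNIV j] algebra_simps)
  qed
  then have "(\<Sum>j\<in>UNIV. 2 * A $ j $ j * \<bar>d $ j\<bar>) \<le> (\<Sum>j\<in>UNIV. \<Sum>i\<in>UNIV. A $ i $ j * \<bar>d $ i\<bar>)"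
    by (intro sum_mono)
  also have "\<dots> = (\<Sum>i\<in>UNIV. \<bar>d $ i\<bar>)"
    by (subst sum.swap) (simp add: row flip: sum_distrib_right)
  finally have "(\<Sum>j\<in>UNIV. (2 * A $ j $ j - 1) * \<bar>d $ j\<bar>) \<le> 0"
    by (simp add: left_diff_distrib sum_subtractf)
  moreover have "0 \<le> (2 * A $ j $ j - 1) * \<bar>d $ j\<bar>" for j
    using half[of j] by simp
  ultimately have "(2 * A $ j $ j - 1) * \<bar>d $ j\<bar> = 0" for j
    using sum_nonneg_eq_0_iff[of UNIV "\<lambda>j. (2 * A $ j $ j - 1) * \<bar>d $ j\<bar>"]
    by (simp add: order_antisym sum_nonneg)
  then have "d $ j = 0" for j
    using half[of j] by (smt (verit) mult_eq_0_iff)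
  then show ?thesis
    by (simp add: d_def vec_eq_iff)
qed

lemma transpose_noise_matrix_simplex:
  assumes A: "noise_matrix A" and p: "p \<in> prob_simplex"
  shows "transpose A *v p \<in> prob_simplex"
proof -
  have "(\<Sum>j\<in>UNIV. \<Sum>i\<in>UNIV. A $ i $ j * p $ i) = (\<Sum>i\<in>UNIV. p $ i)"
    using A by (subst sum.swap) (simp add: noise_matrix_def flip: sum_distrib_right)
  moreover have "0 \<le> A $ i $ j * p $ i" for i j
    using A p by (simp add: noise_matrix_def prob_simplex_def less_imp_le)
  ultimately show ?thesis
    using p by (simp add: prob_simplex_def matrix_vector_mult_def transpose_def sum_nonneg)
qed

section \<open>Proper losses and finiteness of the minimal risk\<close>

lemma axis_simplex: "axis c 1 \<in> prob_simplex"
  by (simp add: prob_simplex_def axis_def)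

text \<open>The convention \<open>0 * \<infinity> = 0\<close> removes the other classes even where
  their loss is infinite, so properness at a vertex speaks about a single
  \<open>l c\<close>.\<close>

lemma expected_loss_axis: "expected_loss l (axis c 1) p = l c p"
proof -
  have "expected_loss l (axis c 1) p = (\<Sum>c'\<in>UNIV. if c' = c then l c p else 0)"
    unfolding expected_loss_def by (intro sum.cong) (auto simp: axis_def)
  then show ?thesis
    by simp
qed

text \<open>Properness at the vertex \<open>axis c 1\<close> says that \<open>l c\<close> is
  smallest there, and that value is not -\<infinity>. Adding up nonnegative bounds over the finitely
  many classes gives one for all.\<close>

lemma proper_loss_bounded_below:
  fixes l :: "'c::finite \<Rightarrow> real ^ 'c \<Rightarrow> ereal"
  assumes "loss_function l" "proper_loss l"
  obtains b :: real where "0 \<le> b" "\<And>c p. p \<in> prob_simplex \<Longrightarrow> - ereal b \<le> l c p"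
proof -
  have "\<exists>b \<ge> 0. - ereal b \<le> l c (axis c 1)" for c
  proof (cases "l c (axis c 1)")
    case (real r)
    then show ?thesis
      by (intro exI[of _ "\<bar>r\<bar>"]) auto
  qed (use assms(1) axis_simplex in \<open>auto simp: loss_function_def\<close>)
  then obtain b where b: "\<And>c. 0 \<le> b c" "\<And>c. - ereal (b c) \<le> l c (axis c 1)"
    by metis
  show ?thesis
  proof
    show "0 \<le> (\<Sum>c\<in>UNIV. b c)"
      by (intro sum_nonneg b)
    fix c and p :: "real ^ 'c" assume p: "p \<in> prob_simplex"
    have "b c \<le> (\<Sum>c\<in>UNIV. b c)"
      by (rule member_le_sum) (auto simp: b)
    then have "- ereal (\<Sum>c\<in>UNIV. b c) \<le> - ereal (b c)"
      by simp
    also have "\<dots> \<le> l c (axis c 1)"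
      by (rule b)
    also have "\<dots> \<le> l c p"
      using assms(2) axis_simplex[of c] p unfolding proper_loss_def by (metis expected_loss_axis)
    finally show "- ereal (\<Sum>c\<in>UNIV. b c) \<le> l c p" .
  qed
qed

text \<open>The shift by a lower bound \<open>-b\<close> of the loss makes all terms nonnegative, so that expectations
  become integrals in \<^typ>\<open>ennreal\<close>.\<close>

definition shifted_risk :: "('c::finite \<Rightarrow> real ^ 'c \<Rightarrow> ereal) \<Rightarrow> real \<Rightarrow> real ^ 'c \<Rightarrow> real ^ 'c \<Rightarrow> ennreal" where
  "shifted_risk l b \<pi> p = (\<Sum>c\<in>UNIV. ennreal (\<pi> $ c) * e2ennreal (l c p + ereal b))"

text \<open>The weights \<open>\<pi> $ c\<close> sum to 1, so shifting every loss by
  \<open>b\<close> shifts the expected loss by exactly \<open>b\<close>.\<close>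

lemma enn2ereal_shifted_risk:
  assumes \<pi>: "\<pi> \<in> prob_simplex" and b: "\<And>c. - ereal b \<le> l c p"
  shows "enn2ereal (shifted_risk l b \<pi> p) = expected_loss l \<pi> p + ereal b"
proof -
  have \<pi>': "0 \<le> \<pi> $ c" "(\<Sum>c\<in>UNIV. \<pi> $ c) = 1" for c
    using \<pi> by (auto simp: prob_simplex_def)
  have "enn2ereal (ennreal (\<pi> $ c) * e2ennreal (l c p + ereal b)) = ereal (\<pi> $ c) * l c p + ereal (\<pi> $ c * b)" for c
    using \<pi>'(1)[of c] b[of c]
    by (cases "l c p") (auto simp: times_ennreal.rep_eq enn2ereal_ennreal enn2ereal_e2ennreal ereal_shift_nonneg algebra_simps)
  then show ?thesis
    by (simp add: shifted_risk_def enn2ereal_sum expected_loss_def ereal_sum_add_const \<pi>' flip: sum_distrib_right)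
qed

lemma shifted_risk_le_iff:
  assumes "\<pi> \<in> prob_simplex" "\<And>c. - ereal b \<le> l c p" "\<And>c. - ereal b \<le> l c q"
  shows "shifted_risk l b \<pi> p \<le> shifted_risk l b \<pi> q \<longleftrightarrow> expected_loss l \<pi> p \<le> expected_loss l \<pi> q"
  unfolding less_eq_ennreal.rep_eq enn2ereal_shifted_risk[where l = l, OF assms(1,2)]
    enn2ereal_shifted_risk[where l = l, OF assms(1,3)]
  by (cases "expected_loss l \<pi> p"; cases "expected_loss l \<pi> q") simp_all

text \<open>An infinite minimum would make the expected loss infinite at \<open>p\<close> too; this
  tie contradicts strictness.\<close>

lemma shifted_risk_self_less_top:
  fixes l :: "'c::finite \<Rightarrow> real ^ 'c \<Rightarrow> ereal"
  assumes l: "strictly_proper_loss l" and b: "\<And>c p. p \<in> prob_simplex \<Longrightarrow> - ereal b \<le> l c p"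
    and \<pi>: "\<pi> \<in> prob_simplex" and p: "p \<in> prob_simplex" "p \<noteq> \<pi>"
  shows "shifted_risk l b \<pi> \<pi> < top"
proof (rule ccontr)
  assume "\<not> ?thesis"
  then have "expected_loss l \<pi> \<pi> + ereal b = \<infinity>"
    using enn2ereal_shifted_risk[where l = l and p = \<pi>, OF \<pi> b[OF \<pi>]]
    by (simp add: less_top[symmetric] top_ennreal.rep_eq top_ereal_def)
  then have "expected_loss l \<pi> \<pi> = \<infinity>"
    by simp
  then show False
    using l \<pi> p unfolding strictly_proper_loss_def proper_loss_def by (metis ereal_infty_less_eq(1))
qed

text \<open>The uniform distribution \<open>u\<close> has finite risk against itself and positive
  weights, hence finite loss on every class. Playing \<open>u\<close> against any \<pi> then bounds
  the minimal risk uniformly in \<pi>.\<close>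

lemma shifted_risk_self_bounded:
  fixes l :: "'c::finite \<Rightarrow> real ^ 'c \<Rightarrow> ereal"
  assumes l: "strictly_proper_loss l" and b: "\<And>c p. p \<in> prob_simplex \<Longrightarrow> - ereal b \<le> l c p"
    and ex: "\<exists>p q. p \<in> prob_simplex \<and> q \<in> prob_simplex \<and> p \<noteq> (q :: real ^ 'c)"
  obtains B where "B < top" "\<And>\<pi>. \<pi> \<in> prob_simplex \<Longrightarrow> shifted_risk l b \<pi> \<pi> \<le> B"
proof
  define u :: "real ^ 'c" where "u = (\<chi> c. 1 / real CARD('c))"
  have u: "u \<in> prob_simplex"
    by (simp add: u_def prob_simplex_def)
  have "shifted_risk l b u u < top"
    using ex shifted_risk_self_less_top[OF l b u] by metis
  then have "ennreal (u $ c) * e2ennreal (l c u + ereal b) \<noteq> top" for c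
    by (simp add: shifted_risk_def less_top)
  \<comment> \<open>A zero weight could hide an infinite loss through
    \<open>0 * top = 0\<close>.\<close>
  moreover have "ennreal (u $ c) \<noteq> 0" for c
    by (simp add: u_def ennreal_eq_0_iff)
  ultimately have "e2ennreal (l c u + ereal b) \<noteq> top" for c
    by (auto simp: ennreal_mult_eq_top_iff)
  then show "(\<Sum>c\<in>UNIV. e2ennreal (l c u + ereal b)) < top"
    by (simp add: less_top[symmetric])
  fix \<pi> :: "real ^ 'c" assume \<pi>: "\<pi> \<in> prob_simplex"
  have "\<pi> $ c \<le> 1" for c
    using \<pi> member_le_sum[of c UNIV "\<lambda>c. \<pi> $ c"] by (simp add: prob_simplex_def)
  then have "ennreal (\<pi> $ c) \<le> 1" for c
    by simp
  then have "shifted_risk l b \<pi> u \<le> (\<Sum>c\<in>UNIV. e2ennreal (l c u + ereal b))"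
    unfolding shifted_risk_def by (intro sum_mono) (metis mult_right_mono mult_1 zero_le)
  moreover have "shifted_risk l b \<pi> \<pi> \<le> shifted_risk l b \<pi> u"
    using l \<pi> u b by (simp add: shifted_risk_le_iff strictly_proper_loss_def proper_loss_def)
  ultimately show "shifted_risk l b \<pi> \<pi> \<le> (\<Sum>c\<in>UNIV. e2ennreal (l c u + ereal b))"
    by simp
qed

text \<open>Each summand is least at \<open>p t = \<pi> t\<close>, so equality of the sums forces
  equality termwise, as long as no infinite term absorbs a strict inequality.\<close>

lemma sum_shifted_risk_eq_iff:
  fixes l :: "'i \<Rightarrow> 'c::finite \<Rightarrow> real ^ 'c \<Rightarrow> ereal"
  assumes I: "finite I"
    and l: "\<And>t. t \<in> I \<Longrightarrow> strictly_proper_loss (l t)"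
    and b: "\<And>t c p. t \<in> I \<Longrightarrow> p \<in> prob_simplex \<Longrightarrow> - ereal (b t) \<le> l t c p"
    and \<pi>: "\<And>t. t \<in> I \<Longrightarrow> \<pi> t \<in> prob_simplex" and p: "\<And>t. t \<in> I \<Longrightarrow> p t \<in> prob_simplex"
  shows "(\<Sum>t\<in>I. shifted_risk (l t) (b t) (\<pi> t) (p t)) = (\<Sum>t\<in>I. shifted_risk (l t) (b t) (\<pi> t) (\<pi> t))
    \<longleftrightarrow> (\<forall>t\<in>I. p t = \<pi> t)"
proof
  let ?R = "\<lambda>t. shifted_risk (l t) (b t) (\<pi> t)"
  assume eq: "(\<Sum>t\<in>I. ?R t (p t)) = (\<Sum>t\<in>I. ?R t (\<pi> t))"
  show "\<forall>t\<in>I. p t = \<pi> t"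
  proof (rule ccontr)
    assume "\<not> (\<forall>t\<in>I. p t = \<pi> t)"
    then obtain s where s: "s \<in> I" "p s \<noteq> \<pi> s"
      by blast
    \<comment> \<open>A single disagreement shows that the simplex has two points, so every
      \<open>\<pi> t\<close> has a competitor and therefore finite minimal risk.\<close>
    then have "\<exists>q \<in> prob_simplex. q \<noteq> r" for r :: "real ^ 'c"
      using \<pi> p by metis
    then have fin: "?R t (\<pi> t) < top" if "t \<in> I" for t
      using shifted_risk_self_less_top[OF l[OF that], where b = "b t" and \<pi> = "\<pi> t"] b \<pi> that by metis
    have le: "?R t (\<pi> t) \<le> ?R t (p t)" if "t \<in> I" for t
      using l \<pi> p b that by (simp add: shifted_risk_le_iff strictly_proper_loss_def proper_loss_def)
    have "\<not> expected_loss (l s) (\<pi> s) (p s) \<le> expected_loss (l s) (\<pi> s) (\<pi> s)"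
      using l \<pi> p s unfolding strictly_proper_loss_def proper_loss_def by (metis order_antisym)
    moreover have "?R s (p s) \<le> ?R s (\<pi> s) \<longleftrightarrow> expected_loss (l s) (\<pi> s) (p s) \<le> expected_loss (l s) (\<pi> s) (\<pi> s)"
      using b \<pi> p s by (intro shifted_risk_le_iff) auto
    ultimately have "?R s (\<pi> s) < ?R s (p s)"
      by (intro not_le_imp_less) blast
    \<comment> \<open>In \<open>ennreal\<close> a strict inequality survives addition only of a
      finite remainder.\<close>
    moreover have "(\<Sum>t\<in>I - {s}. ?R t (\<pi> t)) < top"
      using fin I by (auto simp: less_top)
    ultimately have "(\<Sum>t\<in>I. ?R t (\<pi> t)) < ?R s (p s) + (\<Sum>t\<in>I - {s}. ?R t (\<pi> t))"
      using s I by (simp add: sum.remove[of I s] ennreal_add_left_cancel_less add.commute[of _ "sum _ _"] less_top)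
    also have "\<dots> \<le> (\<Sum>t\<in>I. ?R t (p t))"
      using s I le by (auto simp: sum.remove[of I s] intro!: add_left_mono sum_mono)
    finally show False
      using eq by simp
  qed
qed simp

section \<open>The objectives as integrals of conditional risks\<close>

lemma measurable_loss_comp:
  assumes "loss_function l" and p: "p \<in> borel_measurable N" "\<And>s. s \<in> space N \<Longrightarrow> p s \<in> prob_simplex"
  shows "(\<lambda>s. l c (p s)) \<in> borel_measurable N"
proof -
  have "p \<in> measurable N (restrict_space borel prob_simplex)"
    using p by (intro measurable_restrict_space2) auto
  then show ?thesis
    using assms(1) unfolding loss_function_def by (auto intro: measurable_compose)
qed

lemma measurable_loss_random_label:
  fixes z :: "'w \<Rightarrow> 'c::finite"
  assumes l: "loss_function l"
    and p: "p \<in> borel_measurable N" "\<And>s. s \<in> space N \<Longrightarrow> p s \<in> prob_simplex"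
    and X: "X \<in> measurable M N" and z: "z \<in> measurable M (count_space UNIV)"
  shows "(\<lambda>\<omega>. l (z \<omega>) (p (X \<omega>))) \<in> borel_measurable M"
  using measurable_compose[OF X measurable_loss_comp[OF l p]] z
  by (rule measurable_compose_countable'[where I = UNIV]) (auto simp: countable_finite)

text \<open>Splitting by the value of the label and conditioning each class on \<open>X\<close>
  replaces the random label by its posterior weights.\<close>

lemma nn_integral_shifted_loss:
  fixes z :: "'w \<Rightarrow> 'c::finite"
  assumes "prob_space M" and l: "loss_function l"
    and p: "p \<in> borel_measurable N" "\<And>s. s \<in> space N \<Longrightarrow> p s \<in> prob_simplex"
    and X [measurable]: "X \<in> measurable M N" and z [measurable]: "z \<in> measurable M (count_space UNIV)"
    and \<pi> [measurable]: "\<pi> \<in> borel_measurable M"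
    and post: "\<And>c. AE \<omega> in M. \<pi> \<omega> $ c = cond_pr M X N (\<lambda>w. z w = c) \<omega>"
  shows "(\<integral>\<^sup>+ \<omega>. e2ennreal (l (z \<omega>) (p (X \<omega>)) + ereal b) \<partial>M) = (\<integral>\<^sup>+ \<omega>. shifted_risk l b (\<pi> \<omega>) (p (X \<omega>)) \<partial>M)"
proof -
  define k where "k = (\<lambda>c s. e2ennreal (l c (p s) + ereal b))"
  have k [measurable]: "k c \<in> borel_measurable N" for c
    unfolding k_def using measurable_loss_comp[OF l p] by measurable
  have [measurable]: "(\<lambda>\<omega>. \<pi> \<omega> $ c) \<in> borel_measurable M" for c
    by (rule measurable_compose[OF \<pi>]) (intro borel_measurable_continuous_onI continuous_intros)
  have "(\<integral>\<^sup>+ \<omega>. k (z \<omega>) (X \<omega>) \<partial>M) = (\<integral>\<^sup>+ \<omega>. (\<Sum>c\<in>UNIV. k c (X \<omega>) * indicator {\<omega> \<in> space M. z \<omega> = c} \<omega>) \<partial>M)"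
  proof (rule nn_integral_cong)
    fix \<omega> assume "\<omega> \<in> space M"
    then have "(\<Sum>c\<in>UNIV. k c (X \<omega>) * indicator {\<omega> \<in> space M. z \<omega> = c} \<omega>) = (\<Sum>c\<in>UNIV. if z \<omega> = c then k c (X \<omega>) else 0)"
      by (intro sum.cong) auto
    then show "k (z \<omega>) (X \<omega>) = (\<Sum>c\<in>UNIV. k c (X \<omega>) * indicator {\<omega> \<in> space M. z \<omega> = c} \<omega>)"
      by simp
  qed
  also have "\<dots> = (\<Sum>c\<in>UNIV. \<integral>\<^sup>+ \<omega>. k c (X \<omega>) * indicator {\<omega> \<in> space M. z \<omega> = c} \<omega> \<partial>M)"
    by (rule nn_integral_sum) measurable
  also have "\<dots> = (\<Sum>c\<in>UNIV. \<integral>\<^sup>+ \<omega>. ennreal (\<pi> \<omega> $ c) * k c (X \<omega>) \<partial>M)"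
    by (intro sum.cong refl nn_integral_cond_pr[OF assms(1) X z k post])
  also have "\<dots> = (\<integral>\<^sup>+ \<omega>. (\<Sum>c\<in>UNIV. ennreal (\<pi> \<omega> $ c) * k c (X \<omega>)) \<partial>M)"
    by (rule nn_integral_sum[symmetric]) measurable
  finally show ?thesis
    by (simp add: k_def shifted_risk_def)
qed

text \<open>Additivity is not automatic for extended-real expectations; here both sides reduce to
  the same shifted integral. The noisy objective is an expectation of a sum, the clean one a sum of
  expectations.\<close>

lemma ereal_expectation_sum:
  fixes f :: "'i \<Rightarrow> 'w \<Rightarrow> ereal"
  assumes "prob_space M" and [measurable]: "\<And>t. t \<in> I \<Longrightarrow> f t \<in> borel_measurable M"
    and b: "\<And>t. t \<in> I \<Longrightarrow> 0 \<le> b t" "\<And>t \<omega>. t \<in> I \<Longrightarrow> \<omega> \<in> space M \<Longrightarrow> - ereal (b t) \<le> f t \<omega>"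
  shows "ereal_expectation M (\<lambda>\<omega>. \<Sum>t\<in>I. f t \<omega>) = (\<Sum>t\<in>I. ereal_expectation M (f t))"
    and "(\<Sum>t\<in>I. ereal_expectation M (f t))
      = enn2ereal (\<Sum>t\<in>I. \<integral>\<^sup>+ \<omega>. e2ennreal (f t \<omega> + ereal (b t)) \<partial>M) - ereal (\<Sum>t\<in>I. b t)"
proof -
  have "- ereal (\<Sum>t\<in>I. b t) \<le> (\<Sum>t\<in>I. f t \<omega>)" if "\<omega> \<in> space M" for \<omega>
    using sum_mono[OF b(2)[OF _ that]] by (simp add: sum_negf)
  then have "ereal_expectation M (\<lambda>\<omega>. \<Sum>t\<in>I. f t \<omega>)
      = enn2ereal (\<integral>\<^sup>+ \<omega>. e2ennreal ((\<Sum>t\<in>I. f t \<omega>) + ereal (\<Sum>t\<in>I. b t)) \<partial>M) - ereal (\<Sum>t\<in>I. b t)"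
    using b(1) by (intro ereal_expectation_shift[OF assms(1)] sum_nonneg borel_measurable_sum assms(2)) auto
  also have "(\<integral>\<^sup>+ \<omega>. e2ennreal ((\<Sum>t\<in>I. f t \<omega>) + ereal (\<Sum>t\<in>I. b t)) \<partial>M)
      = (\<integral>\<^sup>+ \<omega>. (\<Sum>t\<in>I. e2ennreal (f t \<omega> + ereal (b t))) \<partial>M)"
    unfolding ereal_sum_add_const[symmetric]
    by (intro nn_integral_cong e2ennreal_sum ereal_shift_nonneg b(2))
  also have "\<dots> = (\<Sum>t\<in>I. \<integral>\<^sup>+ \<omega>. e2ennreal (f t \<omega> + ereal (b t)) \<partial>M)"
    by (rule nn_integral_sum) measurable
  finally have 1: "ereal_expectation M (\<lambda>\<omega>. \<Sum>t\<in>I. f t \<omega>)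
      = enn2ereal (\<Sum>t\<in>I. \<integral>\<^sup>+ \<omega>. e2ennreal (f t \<omega> + ereal (b t)) \<partial>M) - ereal (\<Sum>t\<in>I. b t)" .
  have "(\<Sum>t\<in>I. ereal_expectation M (f t))
      = (\<Sum>t\<in>I. enn2ereal (\<integral>\<^sup>+ \<omega>. e2ennreal (f t \<omega> + ereal (b t)) \<partial>M) - ereal (b t))"
    by (intro sum.cong refl ereal_expectation_shift[OF assms(1)] assms(2) b)
  then show 2: "(\<Sum>t\<in>I. ereal_expectation M (f t))
      = enn2ereal (\<Sum>t\<in>I. \<integral>\<^sup>+ \<omega>. e2ennreal (f t \<omega> + ereal (b t)) \<partial>M) - ereal (\<Sum>t\<in>I. b t)"
    by (simp only: ereal_sum_minus_const enn2ereal_sum)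
  show "ereal_expectation M (\<lambda>\<omega>. \<Sum>t\<in>I. f t \<omega>) = (\<Sum>t\<in>I. ereal_expectation M (f t))"
    by (simp only: 1 2)
qed

text \<open>The common core for both kinds of labels: \<open>z\<close> may be clean or noisy, with
  \<open>p\<close> the model or its image under the transposed noise matrix. The minimizers do not
  depend on the loss, which is why the two problems can be compared.\<close>

lemma argmin_set_expected_loss:
  fixes l :: "'i \<Rightarrow> 'c::finite \<Rightarrow> real ^ 'c \<Rightarrow> ereal" and z :: "'i \<Rightarrow> 'w \<Rightarrow> 'c"
    and p :: "'p \<Rightarrow> 'i \<Rightarrow> 'a \<Rightarrow> real ^ 'c"
  assumes "prob_space M" and "finite I"
    and l: "\<And>t. t \<in> I \<Longrightarrow> loss_function (l t)" "\<And>t. t \<in> I \<Longrightarrow> strictly_proper_loss (l t)"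
    and X: "\<And>t. t \<in> I \<Longrightarrow> X t \<in> measurable M (N t)"
    and z: "\<And>t. t \<in> I \<Longrightarrow> z t \<in> measurable M (count_space UNIV)"
    and p: "\<And>\<theta> t. \<theta> \<in> \<Theta> \<Longrightarrow> t \<in> I \<Longrightarrow> p \<theta> t \<in> borel_measurable (N t)"
      "\<And>\<theta> t s. \<theta> \<in> \<Theta> \<Longrightarrow> t \<in> I \<Longrightarrow> s \<in> space (N t) \<Longrightarrow> p \<theta> t s \<in> prob_simplex"
    and \<theta>\<^sub>0: "\<theta>\<^sub>0 \<in> \<Theta>"
    and post: "\<And>t c. t \<in> I \<Longrightarrow> AE \<omega> in M. p \<theta>\<^sub>0 t (X t \<omega>) $ c = cond_pr M (X t) (N t) (\<lambda>w. z t w = c) \<omega>"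
  shows "argmin_set (\<lambda>\<theta>. ereal_expectation M (\<lambda>\<omega>. \<Sum>t\<in>I. l t (z t \<omega>) (p \<theta> t (X t \<omega>)))) \<Theta>
      = {\<theta> \<in> \<Theta>. AE \<omega> in M. \<forall>t\<in>I. p \<theta> t (X t \<omega>) = p \<theta>\<^sub>0 t (X t \<omega>)}" (is "argmin_set ?f _ = ?S")
    and "argmin_set (\<lambda>\<theta>. \<Sum>t\<in>I. ereal_expectation M (\<lambda>\<omega>. l t (z t \<omega>) (p \<theta> t (X t \<omega>)))) \<Theta>
      = {\<theta> \<in> \<Theta>. AE \<omega> in M. \<forall>t\<in>I. p \<theta> t (X t \<omega>) = p \<theta>\<^sub>0 t (X t \<omega>)}" (is "argmin_set ?g _ = ?S")
proof -
  interpret prob_space M by fact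
  have "\<exists>b\<ge>0. \<forall>c. \<forall>q \<in> prob_simplex. - ereal b \<le> l t c q" if "t \<in> I" for t
    using proper_loss_bounded_below[of "l t"] l[OF that] unfolding strictly_proper_loss_def by metis
  then obtain b where b: "\<And>t. t \<in> I \<Longrightarrow> 0 \<le> b t"
      "\<And>t c q. t \<in> I \<Longrightarrow> q \<in> prob_simplex \<Longrightarrow> - ereal (b t) \<le> l t c q"
    by metis
  define P where "P \<theta> t \<omega> = p \<theta> t (X t \<omega>)" for \<theta> t \<omega>
  have P [measurable]: "P \<theta> t \<in> borel_measurable M" if "\<theta> \<in> \<Theta>" "t \<in> I" for \<theta> t
    unfolding P_def using p(1)[OF that] X[OF that(2)] by measurable
  have P_simplex: "P \<theta> t \<omega> \<in> prob_simplex" if "\<theta> \<in> \<Theta>" "t \<in> I" "\<omega> \<in> space M" for \<theta> t \<omega>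
    unfolding P_def using measurable_space[OF X] that by (intro p(2))
  \<comment> \<open>The predictions of \<open>\<theta>\<^sub>0\<close> serve as the version of the
    posterior. They lie in the simplex everywhere, not just almost surely, so minimality holds at
    every point of the space.\<close>
  define F where "F \<theta> \<omega> = (\<Sum>t\<in>I. shifted_risk (l t) (b t) (P \<theta>\<^sub>0 t \<omega>) (P \<theta> t \<omega>))" for \<theta> \<omega>
  have risk_meas [measurable]: "(\<lambda>\<omega>. shifted_risk (l t) (b t) (P \<theta>\<^sub>0 t \<omega>) (P \<theta> t \<omega>)) \<in> borel_measurable M"
    if "\<theta> \<in> \<Theta>" "t \<in> I" for \<theta> t
  proof -
    have [measurable]: "(\<lambda>\<omega>. l t c (P \<theta> t \<omega>)) \<in> borel_measurable M" for c
      by (rule measurable_loss_comp[OF l(1)[OF that(2)] P[OF that] P_simplex[OF that]])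
    have [measurable]: "(\<lambda>\<omega>. P \<theta>\<^sub>0 t \<omega> $ c) \<in> borel_measurable M" for c
      by (rule measurable_compose[OF P[OF \<theta>\<^sub>0 that(2)]])
         (intro borel_measurable_continuous_onI continuous_intros)
    show ?thesis
      unfolding shifted_risk_def by measurable
  qed
  have g: "?g \<theta> = enn2ereal (integral\<^sup>N M (F \<theta>)) - ereal (\<Sum>t\<in>I. b t)"
    and fg: "?f \<theta> = ?g \<theta>" if "\<theta> \<in> \<Theta>" for \<theta>
  proof -
    have meas: "(\<lambda>\<omega>. l t (z t \<omega>) (p \<theta> t (X t \<omega>))) \<in> borel_measurable M" if "t \<in> I" for t
      by (rule measurable_loss_random_label[OF l(1) p X z]) (use that \<open>\<theta> \<in> \<Theta>\<close> in auto)
    have bound: "- ereal (b t) \<le> l t (z t \<omega>) (p \<theta> t (X t \<omega>))" if "t \<in> I" "\<omega> \<in> space M" for t \<omega>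
      using b(2) P_simplex[OF \<open>\<theta> \<in> \<Theta>\<close> that] that by (simp add: P_def)
    have "(\<integral>\<^sup>+ \<omega>. e2ennreal (l t (z t \<omega>) (p \<theta> t (X t \<omega>)) + ereal (b t)) \<partial>M)
        = (\<integral>\<^sup>+ \<omega>. shifted_risk (l t) (b t) (P \<theta>\<^sub>0 t \<omega>) (p \<theta> t (X t \<omega>)) \<partial>M)" if "t \<in> I" for t
      by (rule nn_integral_shifted_loss[OF assms(1) l(1) p X z P])
         (use that \<open>\<theta> \<in> \<Theta>\<close> \<theta>\<^sub>0 post[OF that] in \<open>auto simp: P_def\<close>)
    then have "(\<Sum>t\<in>I. \<integral>\<^sup>+ \<omega>. e2ennreal (l t (z t \<omega>) (p \<theta> t (X t \<omega>)) + ereal (b t)) \<partial>M) = integral\<^sup>N M (F \<theta>)"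
      unfolding F_def using risk_meas[OF \<open>\<theta> \<in> \<Theta>\<close>] by (subst nn_integral_sum) (auto simp: P_def)
    then show "?g \<theta> = enn2ereal (integral\<^sup>N M (F \<theta>)) - ereal (\<Sum>t\<in>I. b t)"
      by (subst ereal_expectation_sum(2)[where b = b, OF assms(1) meas b(1) bound]) simp_all
    show "?f \<theta> = ?g \<theta>"
      by (rule ereal_expectation_sum(1)[OF assms(1) meas b(1) bound])
  qed
  have F_min: "F \<theta>\<^sub>0 \<omega> \<le> F \<theta> \<omega>" if "\<theta> \<in> \<Theta>" "\<omega> \<in> space M" for \<theta> \<omega>
    unfolding F_def
  proof (rule sum_mono)
    fix t assume t: "t \<in> I"
    note PP = P_simplex[OF \<theta>\<^sub>0 t that(2)] P_simplex[OF that(1) t that(2)]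
    then show "shifted_risk (l t) (b t) (P \<theta>\<^sub>0 t \<omega>) (P \<theta>\<^sub>0 t \<omega>) \<le> shifted_risk (l t) (b t) (P \<theta>\<^sub>0 t \<omega>) (P \<theta> t \<omega>)"
      using l(2)[OF t] b(2)[OF t] by (simp add: shifted_risk_le_iff strictly_proper_loss_def proper_loss_def)
  qed
  have F_fin: "integral\<^sup>N M (F \<theta>\<^sub>0) < \<infinity> \<or> (\<forall>\<theta>\<in>\<Theta>. \<forall>\<omega>\<in>space M. F \<theta> \<omega> = F \<theta>\<^sub>0 \<omega>)"
  proof (cases "\<exists>q q'. q \<in> prob_simplex \<and> q' \<in> prob_simplex \<and> q \<noteq> (q' :: real ^ 'c)")
    case True
    have "\<exists>B < top. \<forall>q \<in> prob_simplex. shifted_risk (l t) (b t) q q \<le> B" if "t \<in> I" for t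
      using shifted_risk_self_bounded[OF l(2)[OF that] b(2)[OF that] True] by metis
    then obtain B where B: "\<And>t. t \<in> I \<Longrightarrow> B t < top"
        "\<And>t q. t \<in> I \<Longrightarrow> q \<in> prob_simplex \<Longrightarrow> shifted_risk (l t) (b t) q q \<le> B t"
      by metis
    have "integral\<^sup>N M (F \<theta>\<^sub>0) \<le> (\<integral>\<^sup>+ \<omega>. (\<Sum>t\<in>I. B t) \<partial>M)"
      unfolding F_def by (intro nn_integral_mono sum_mono B(2) P_simplex[OF \<theta>\<^sub>0])
    also have "\<dots> < top"
      using B(1) \<open>finite I\<close> by (auto simp: emeasure_space_1 less_top[symmetric])
    finally show ?thesis
      by simp
  next
    case False
    \<comment> \<open>The simplex has at most one point, so all predictions coincide.\<close>
    then have "P \<theta> t \<omega> = P \<theta>\<^sub>0 t \<omega>" if "\<theta> \<in> \<Theta>" "t \<in> I" "\<omega> \<in> space M" for \<theta> t \<omega>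
      using P_simplex \<theta>\<^sub>0 that by metis
    then show ?thesis
      by (simp add: F_def)
  qed
  have F_eq: "F \<theta> \<omega> = F \<theta>\<^sub>0 \<omega> \<longleftrightarrow> (\<forall>t\<in>I. P \<theta> t \<omega> = P \<theta>\<^sub>0 t \<omega>)" if "\<theta> \<in> \<Theta>" "\<omega> \<in> space M" for \<theta> \<omega>
    unfolding F_def using sum_shifted_risk_eq_iff[OF \<open>finite I\<close> l(2) b(2)] P_simplex that \<theta>\<^sub>0 by simp
  have "F \<theta> \<in> borel_measurable M" if "\<theta> \<in> \<Theta>" for \<theta>
    unfolding F_def using risk_meas[OF that] by simp
  note argmin = argmin_set_integral[OF \<theta>\<^sub>0 this F_min F_fin]
  have set_eq: "{\<theta> \<in> \<Theta>. AE \<omega> in M. F \<theta> \<omega> = F \<theta>\<^sub>0 \<omega>} = ?S"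
    using F_eq by (auto simp: P_def cong: AE_cong_simp)
  show "argmin_set ?g \<Theta> = ?S" "argmin_set ?f \<Theta> = ?S"
    unfolding set_eq[symmetric] by (rule argmin; simp add: fg g)+
qed

section \<open>Comparison of the noisy and clean problems\<close>

theorem proposition1:
  fixes M :: "'w measure" and T :: nat
    and x :: "nat \<Rightarrow> 'w \<Rightarrow> real ^ 'd::finite"
    and y yn :: "nat \<Rightarrow> 'w \<Rightarrow> 'c::finite"
    and Q :: "real \<Rightarrow> real ^ 'c ^ 'c"
    and l :: "nat \<Rightarrow> 'c \<Rightarrow> real ^ 'c \<Rightarrow> ereal"
    and \<psi> \<phi> :: "real ^ 'c \<Rightarrow> real ^ 'c"
    and \<Theta> :: "'p set"
    and g h :: "'p \<Rightarrow> nat \<Rightarrow> (nat \<Rightarrow> real ^ 'd) \<Rightarrow> real ^ 'c"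
  assumes "prob_space M" and "1 \<le> T"
    and "\<And>t. t \<in> {1..T} \<Longrightarrow> x t \<in> measurable M borel"
    and "\<And>t. t \<in> {1..T} \<Longrightarrow> y t \<in> measurable M (count_space UNIV)"
    and "\<And>t. t \<in> {1..T} \<Longrightarrow> yn t \<in> measurable M (count_space UNIV)"
    and "future_independence M T x y"
    and "feature_independence M T x y yn"
    and "noisy_factorization M T x y yn Q"
    and "label_noise_function M T y yn Q"
    and "\<And>t. t \<in> {1..T} \<Longrightarrow> proper_composite_loss \<psi> \<phi> (l t)"
    and "\<And>\<theta>. \<theta> \<in> \<Theta> \<Longrightarrow> temporal_model T \<phi> (g \<theta>) (h \<theta>)"
    and strict: "\<And>t. t \<in> {1..T} \<Longrightarrow> strictly_proper_loss (l t)"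
    and realizable: "\<exists>\<theta> \<in> \<Theta>. estimates_posterior_exactly M T x y (h \<theta>)"
  shows "argmin_set (\<lambda>\<theta>. ereal_expectation M
             (\<lambda>\<omega>. forward_temporal_loss T l Q (\<lambda>t. yn t \<omega>) (\<lambda>t. x t \<omega>) (h \<theta>))) \<Theta>
       = argmin_set (\<lambda>\<theta>. \<Sum>t = 1..T. ereal_expectation M
             (\<lambda>\<omega>. l t (y t \<omega>) (h \<theta> t (history x t \<omega>)))) \<Theta>"
proof -
  obtain \<theta>\<^sub>0 where \<theta>\<^sub>0: "\<theta>\<^sub>0 \<in> \<Theta>" "estimates_posterior_exactly M T x y (h \<theta>\<^sub>0)"
    using realizable by blast
  have l: "loss_function (l t)" and \<phi>: "\<phi> v \<in> prob_simplex" if "t \<in> {1..T}" for t v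
    using assms(10)[OF that] by (auto simp: proper_composite_loss_def link_with_inverse_def)
  have hist: "history x t \<in> measurable M (feature_space t)" if "t \<in> {1..T}" for t
    unfolding history_def upto_time_def by (rule measurable_restrict) (use assms(3) that in auto)
  have h: "h \<theta> t \<in> borel_measurable (feature_space t)"
      "\<And>s. s \<in> space (feature_space t) \<Longrightarrow> h \<theta> t s \<in> prob_simplex" if "\<theta> \<in> \<Theta>" "t \<in> {1..T}" for \<theta> t
    using assms(11)[OF that(1)] \<phi>[OF that(2)] that(2) by (auto simp: temporal_model_def)
  have post: "AE \<omega> in M. h \<theta>\<^sub>0 t (history x t \<omega>) $ c
      = cond_pr M (history x t) (feature_space t) (\<lambda>w. y t w = c) \<omega>" if "t \<in> {1..T}" for t c
    using \<theta>\<^sub>0(2) that by (auto simp: estimates_posterior_exactly_def)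
  have noise: "noise_matrix (Q (real t))" if "t \<in> {1..T}" for t
    using assms(9) that by (auto simp: label_noise_function_def)
  \<comment> \<open>The noisy factorization turns an exact clean posterior into an exact noisy one,
    so \<open>\<theta>\<^sub>0\<close> is a reference model for both problems.\<close>
  have noisy_post: "AE \<omega> in M. (transpose (Q (real t)) *v h \<theta>\<^sub>0 t (history x t \<omega>)) $ j
      = cond_pr M (history x t) (feature_space t) (\<lambda>w. yn t w = j) \<omega>" if "t \<in> {1..T}" for t j
  proof -
    have "AE \<omega> in M. \<forall>i. h \<theta>\<^sub>0 t (history x t \<omega>) $ i
        = cond_pr M (history x t) (feature_space t) (\<lambda>w. y t w = i) \<omega>"
      using post[OF that] by (simp add: AE_all_countable)
    moreover have "AE \<omega> in M. cond_pr M (history x t) (feature_space t) (\<lambda>w. yn t w = j) \<omega>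
        = (\<Sum>i\<in>UNIV. Q (real t) $ i $ j * cond_pr M (history x t) (feature_space t) (\<lambda>w. y t w = i) \<omega>)"
      using assms(8) that by (auto simp: noisy_factorization_def)
    ultimately show ?thesis
      by eventually_elim (simp add: matrix_vector_mult_def transpose_def)
  qed
  have noisy_h: "(\<lambda>s. transpose (Q (real t)) *v h \<theta> t s) \<in> borel_measurable (feature_space t)"
    if "\<theta> \<in> \<Theta>" "t \<in> {1..T}" for \<theta> t
    using h(1)[OF that]
    by (rule measurable_compose)
       (intro borel_measurable_continuous_onI linear_continuous_on linear_conv_bounded_linear[THEN iffD1] matrix_vector_mul_linear)
  have "argmin_set (\<lambda>\<theta>. ereal_expectation M
      (\<lambda>\<omega>. \<Sum>t = 1..T. l t (yn t \<omega>) (transpose (Q (real t)) *v h \<theta> t (history x t \<omega>)))) \<Theta>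
    = {\<theta> \<in> \<Theta>. AE \<omega> in M. \<forall>t\<in>{1..T}.
        transpose (Q (real t)) *v h \<theta> t (history x t \<omega>) = transpose (Q (real t)) *v h \<theta>\<^sub>0 t (history x t \<omega>)}"
    by (rule argmin_set_expected_loss(1)[where p = "\<lambda>\<theta> t s. transpose (Q (real t)) *v h \<theta> t s",
          OF assms(1) finite_atLeastAtMost l strict hist assms(5) noisy_h
          transpose_noise_matrix_simplex[OF noise h(2)] \<theta>\<^sub>0(1) noisy_post])
  \<comment> \<open>Injectivity of the transposed noise matrices identifies the two conditions
    pointwise.\<close>
  also have "\<dots> = {\<theta> \<in> \<Theta>. AE \<omega> in M. \<forall>t\<in>{1..T}. h \<theta> t (history x t \<omega>) = h \<theta>\<^sub>0 t (history x t \<omega>)}"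
  proof -
    have "transpose (Q (real t)) *v u = transpose (Q (real t)) *v v \<longleftrightarrow> u = v" if "t \<in> {1..T}" for t u v
      using transpose_noise_matrix_inj[OF noise[OF that]] by blast
    then show ?thesis
      by simp
  qed
  also have "\<dots> = argmin_set (\<lambda>\<theta>. \<Sum>t = 1..T. ereal_expectation M
      (\<lambda>\<omega>. l t (y t \<omega>) (h \<theta> t (history x t \<omega>)))) \<Theta>"
    by (rule argmin_set_expected_loss(2)[where p = h, OF assms(1) finite_atLeastAtMost l strict hist assms(4) h \<theta>\<^sub>0(1) post, symmetric])
  finally show ?thesis
    by (simp add: forward_temporal_loss_def history_def)
qed

end
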